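(* Let $\{P_\theta : \theta\in\mathbb{R}^p\}$ be a probability model with densities $f_\theta$ with respect to a measure $\lambda$, all almost surely positive, and suppose that its log likelihood is $$l(\theta) = U + Z'\theta - \tfrac12\,\theta' K\theta,\qquad \theta\in\mathbb{R}^p,$$ where $U$ is a random scalar, $Z$ is a random $p$-vector, and $K$ is a random symmetric $p\times p$ matrix (all measurable functions of the data, not depending on $\theta$). Then (a) $K$ is almost surely positive semi-definite. Also, the following two conditions are equivalent: (b) for every $\theta\in\mathbb{R}^p$, the conditional distribution of $Z$ given $K$ for parameter value $\theta$ (i.e. under $P_\theta$) is $\mathcal{N}(K\theta, K)$; (c) the distribution of $K$ under $P_\theta$ does not depend on the parameter $\theta$.
   Context: The data $X$ is a random element of a sample space; under parameter value $\theta$ it has density $f_\theta$ with respect to $\lambda$. The log likelihood of the model is the random function $l(\theta) = u(X) + \log f_\theta(X)$, where $u$ is any real-valued function on the sample space that does not depend on $\theta$. All densities are assumed almost surely positive, so all distributions in the family are mutually absolutely continuous and "almost surely" does not depend on $\theta$; consequently $E_{\theta+\delta}\{g(X)\} = E_\theta\{g(X)e^{l(\theta+\delta)-l(\theta)}\}$ for bounded $g$. A prime denotes transpose. $\mathcal{N}(m,V)$ is the multivariate normal distribution with mean vector $m$ and (possibly singular) variance matrix $V$. *)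

theory Defs
  imports "HOL-Probability.Probability"
begin

definition psd :: "real ^ 'n ^ 'n \<Rightarrow> bool" where
  "psd A \<longleftrightarrow> transpose A = A \<and> (\<forall>v. 0 \<le> v \<bullet> (A *v v))"

definition std_mvn :: "(real ^ 'n) measure" where
  "std_mvn = distr (\<Pi>\<^sub>M i\<in>UNIV. density lborel std_normal_density) borel (\<lambda>w. \<chi> i. w i)"

text \<open>
  The normal law with mean vector \<open>m\<close> and possibly singular variance matrix \<open>V\<close> is the law of
  \<open>m + A W\<close> with \<open>W\<close> standard normal and \<open>A A' = V\<close>; such \<open>A\<close> exists exactly when \<open>V\<close> is positive
  semi-definite, and the law does not depend on which one is chosen.  The other branch only makes
  the function total, with a value that is a probability measure depending measurably on \<open>m\<close>.
\<close>

definition mvn :: "real ^ 'n \<Rightarrow> real ^ 'n ^ 'n \<Rightarrow> (real ^ 'n) measure" where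
  "mvn m V = (if psd V
     then distr std_mvn borel (\<lambda>w. m + (SOME A :: real ^ 'n ^ 'n. A ** transpose A = V) *v w)
     else return borel m)"

text \<open>
  \<open>cond_distribution M N Z L K \<kappa>\<close>: the probability kernel \<open>\<kappa>\<close> is a regular conditional
  distribution of the \<open>N\<close>-valued \<open>Z\<close> given the \<open>L\<close>-valued \<open>K\<close> under \<open>M\<close>, that is,
  \<open>\<kappa> (K x) B\<close> is a version of the conditional probability of the event \<open>Z \<in> B\<close> given the
  sigma-algebra generated by \<open>K\<close>.
\<close>

definition cond_distribution ::
  "'a measure \<Rightarrow> 'b measure \<Rightarrow> ('a \<Rightarrow> 'b) \<Rightarrow> 'c measure \<Rightarrow> ('a \<Rightarrow> 'c) \<Rightarrow> ('c \<Rightarrow> 'b measure) \<Rightarrow> bool"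
where
  "cond_distribution M N Z L K \<kappa> \<longleftrightarrow>
     \<kappa> \<in> L \<rightarrow>\<^sub>M prob_algebra N \<and>
     (\<forall>B\<in>sets N. AE x in M.
        real_cond_exp M (vimage_algebra (space M) K L) (\<lambda>x. indicator B (Z x)) x
          = measure (\<kappa> (K x)) B)"

definition model :: "'a measure \<Rightarrow> ('t \<Rightarrow> 'a \<Rightarrow> real) \<Rightarrow> 't \<Rightarrow> 'a measure" where
  "model lam f \<theta> = density lam (\<lambda>x. ennreal (f \<theta> x))"

text \<open>
  Almost sure positivity refers to the distributions of the family: each density is positive with
  probability one under each parameter value, so the distributions are mutually absolutely
  continuous.  The dominating measure may still charge a set on which all densities vanish.
\<close>

locale probability_model =
  fixes lam :: "'a measure" and f :: "'t \<Rightarrow> 'a \<Rightarrow> real"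
  assumes density_measurable: "\<And>\<theta>. f \<theta> \<in> borel_measurable lam"
    and density_nonneg: "\<And>\<theta> x. x \<in> space lam \<Longrightarrow> 0 \<le> f \<theta> x"
    and prob_space_model: "\<And>\<theta>. prob_space (model lam f \<theta>)"
    and density_pos: "\<And>\<theta> \<theta>'. AE x in model lam f \<theta>. 0 < f \<theta>' x"

text \<open>The function \<open>u\<close> is the arbitrary additive term not depending on the parameter.\<close>

definition loglik :: "('a \<Rightarrow> real) \<Rightarrow> ('t \<Rightarrow> 'a \<Rightarrow> real) \<Rightarrow> 't \<Rightarrow> 'a \<Rightarrow> real" where
  "loglik u f \<theta> x = u x + ln (f \<theta> x)"

end

theory Submission
  imports Defs "HOL-Complex_Analysis.Conformal_Mappings"
begin

text \<open>
  Fix a base point \<open>\<theta>\<close>.  Completing the square in the log likelihood gives the likelihood ratio between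
  \<open>\<theta> + t\<close> and \<open>\<theta>\<close> as \<open>exp (t \<bullet> (Z - K \<theta>) - t \<bullet> K t / 2)\<close>, which has mean one under \<open>\<theta>\<close> for every \<open>t\<close>
  (\<open>model_shift\<close>).

  Part (a): along a direction \<open>v\<close> with \<open>v \<bullet> K v\<close> negative on an event of positive probability, the summed means of
  the ratios at \<open>s v\<close> and \<open>- s v\<close> would be unbounded in \<open>s\<close> (\<open>K_direction_nonneg\<close>); countably many
  directions settle the matter (\<open>K_psd\<close>).

  From (b) to (c): if \<open>Z\<close> given \<open>K\<close> is \<open>N(K \<theta>, K)\<close>, then the likelihood ratio has conditional mean one given
  \<open>K\<close>, and changing the parameter does not change the law of \<open>K\<close> (\<open>distr_K_shift\<close>).

  From (c) to (b): write \<open>exp (t \<bullet> Z)\<close> as the likelihood ratio times the function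
  \<open>exp (t \<bullet> K \<theta> + t \<bullet> K t / 2)\<close> of \<open>K\<close>.  Changing the parameter to \<open>\<theta> + t\<close> absorbs the ratio, and by (c) the
  change is invisible to functions of \<open>K\<close>.  So that function is the conditional moment generating function
  of \<open>Z\<close> given \<open>K\<close> (\<open>conditional_mgf\<close>), and it is the one of \<open>N(K \<theta>, K)\<close>.  Since \<open>K\<close> can have heavy tails, the
  unconditional transforms can be infinite, so the comparison is made on events where \<open>K\<close> is bounded
  (\<open>bounded_rectangle_mvn\<close>).

  Two general facts are behind this.  A finite measure on a Euclidean space whose moment generating
  function is finite everywhere is determined by it (\<open>measure_eqI_mgf\<close>): in one dimension by analytic
  continuation to the characteristic function, in several by treating one coordinate at a time.  And
  \<open>N(m, V)\<close> depends measurably on \<open>m\<close> and \<open>V\<close> (\<open>mvn_measurable\<close>), also at singular \<open>V\<close>: all roots of \<open>V\<close>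
  yield the same law, and Gaussian elimination provides a measurable one.
\<close>

section \<open>Uniqueness of moment generating functions\<close>

text \<open>
  The complex exponential is expanded termwise.  Its partial sums at \<open>z\<close> are dominated by
  \<open>exp (\<bar>z\<bar> \<bar>x\<bar>) \<le> exp (\<bar>z\<bar> x) + exp (- \<bar>z\<bar> x)\<close>, which is integrable as the moment generating function
  is finite on both half-lines.
\<close>

lemma mgf_entire_extension:
  fixes M :: "real measure"
  assumes "sets M = sets borel"
    and fin: "\<And>s. (\<integral>\<^sup>+x. ennreal (exp (s * x)) \<partial>M) < \<infinity>"
  obtains a :: "nat \<Rightarrow> complex"
  where "\<And>z. (\<lambda>n. a n * z ^ n) sums (\<integral>x. exp (z * complex_of_real x) \<partial>M)"
proof -
  note [measurable_cong] = assms(1)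
  let ?f = "\<lambda>(z::complex) (n::nat) (x::real). (z * of_real x) ^ n / fact n"
  have intexp: "integrable M (\<lambda>x. exp (s * x))" for s :: real
    using fin[of s] by (intro integrableI_bounded) auto
  have sm: "summable (\<lambda>n. norm (?f z n x))" for z x
    using summable_norm_exp[of "z * of_real x"]
    by (simp add: divide_inverse mult.commute norm_mult norm_inverse norm_power)
  have dom: "(\<Sum>n. norm (?f z n x)) = exp (norm z * \<bar>x\<bar>)" for z x
    by (simp add: exp_def norm_divide norm_power norm_mult norm_inverse divide_inverse mult.commute)
  have domint: "integrable M (\<lambda>x. exp (norm z * \<bar>x\<bar>))" for z :: complex
  proof (rule Bochner_Integration.integrable_bound)
    show "integrable M (\<lambda>x. exp (norm z * x) + exp (- norm z * x))"
      using intexp[of "norm z"] intexp[of "- norm z"] by (rule Bochner_Integration.integrable_add)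
    show "AE x in M. norm (exp (norm z * \<bar>x\<bar>)) \<le> norm (exp (norm z * x) + exp (- norm z * x))"
    proof (rule AE_I2)
      fix x
      have "norm (exp (norm z * x) + exp (- norm z * x)) = exp (norm z * x) + exp (- norm z * x)"
        by (simp add: add_nonneg_nonneg)
      then show "norm (exp (norm z * \<bar>x\<bar>)) \<le> norm (exp (norm z * x) + exp (- norm z * x))"
        by (cases "x < 0") simp_all
    qed
  qed measurable
  have int: "integrable M (?f z n)" for z n
  proof (rule Bochner_Integration.integrable_bound[OF domint[of z]])
    show "AE x in M. norm (?f z n x) \<le> norm (exp (norm z * \<bar>x\<bar>))"
    proof (rule AE_I2)
      fix x
      have "sum (\<lambda>n. norm (?f z n x)) {n} \<le> (\<Sum>n. norm (?f z n x))"
        by (rule sum_le_suminf[OF sm]) auto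
      then show "norm (?f z n x) \<le> norm (exp (norm z * \<bar>x\<bar>))"
        unfolding dom by simp
    qed
  qed measurable
  have smn: "summable (\<lambda>n. \<integral>x. norm (?f z n x) \<partial>M)" for z
  proof (rule bounded_imp_summable)
    fix N
    have "(\<Sum>n\<le>N. \<integral>x. norm (?f z n x) \<partial>M) = (\<integral>x. (\<Sum>n\<le>N. norm (?f z n x)) \<partial>M)"
      using int by (intro Bochner_Integration.integral_sum[symmetric]) auto
    also have "\<dots> \<le> (\<integral>x. exp (norm z * \<bar>x\<bar>) \<partial>M)"
    proof (rule integral_mono)
      show "(\<Sum>n\<le>N. norm (?f z n x)) \<le> exp (norm z * \<bar>x\<bar>)" for x
        unfolding dom[symmetric] by (rule sum_le_suminf[OF sm]) auto
    qed (use int domint in auto)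
    finally show "(\<Sum>n\<le>N. \<integral>x. norm (?f z n x) \<partial>M) \<le> (\<integral>x. exp (norm z * \<bar>x\<bar>) \<partial>M)" .
  qed simp
  have "(\<lambda>n. integral\<^sup>L M (?f z n)) sums (\<integral>x. (\<Sum>n. ?f z n x) \<partial>M)" for z
    by (rule sums_integral[OF int _ smn]) (use sm in auto)
  moreover have "(\<Sum>n. ?f z n x) = exp (z * of_real x)" for z x
    by (simp add: exp_def scaleR_conv_of_real divide_inverse mult.commute)
  moreover have "integral\<^sup>L M (?f z n) = (\<integral>x. of_real x ^ n / fact n \<partial>M) * z ^ n" for z n
    by (simp add: power_mult_distrib mult.commute flip: times_divide_eq_right)
  ultimately show ?thesis
    by (intro that[of "\<lambda>n. \<integral>x. of_real x ^ n / fact n \<partial>M"]) simp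
qed

text \<open>
  The two transforms extend to entire functions.  These agree on the real axis, hence everywhere, and
  on the imaginary axis they are the characteristic functions, so the uniqueness theorem of Levy
  applies after normalising the common total mass.
\<close>

lemma measure_eqI_mgf_real:
  fixes M N :: "real measure"
  assumes sM: "sets M = sets borel" and sN: "sets N = sets borel"
    and eq: "\<And>s. (\<integral>\<^sup>+x. ennreal (exp (s * x)) \<partial>M) = (\<integral>\<^sup>+x. ennreal (exp (s * x)) \<partial>N)"
    and fin: "\<And>s. (\<integral>\<^sup>+x. ennreal (exp (s * x)) \<partial>M) < \<infinity>"
  shows "M = N"
proof -
  note [measurable_cong] = sM sN
  have finN: "(\<integral>\<^sup>+x. ennreal (exp (s * x)) \<partial>N) < \<infinity>" for s
    using fin eq by simp
  have spM: "space M = UNIV" and spN: "space N = UNIV"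
    using sM sN by (auto dest: sets_eq_imp_space_eq)
  obtain a where a: "\<And>z. (\<lambda>n. a n * z ^ n) sums (\<integral>x. exp (z * complex_of_real x) \<partial>M)"
    using mgf_entire_extension[OF sM fin] by metis
  obtain b where b: "\<And>z. (\<lambda>n. b n * z ^ n) sums (\<integral>x. exp (z * complex_of_real x) \<partial>N)"
    using mgf_entire_extension[OF sN finN] by metis
  define F where "F z = (\<integral>x. exp (z * complex_of_real x) \<partial>M)
      - (\<integral>x. exp (z * complex_of_real x) \<partial>N)" for z
  have F_sums: "(\<lambda>n. (a n - b n) * (z - 0) ^ n) sums F z" for z
    using sums_diff[OF a[of z] b[of z]] unfolding F_def by (simp add: algebra_simps)
  have hol: "F holomorphic_on UNIV"
  proof -
    have "F holomorphic_on ball 0 r" for r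
      by (rule power_series_holomorphic[of 0 r "\<lambda>n. a n - b n"]) (rule F_sums)
    then show ?thesis
      unfolding holomorphic_on_open[OF open_UNIV] holomorphic_on_open[OF open_ball]
      by (meson UNIV_I mem_ball_0 gt_ex)
  qed
  have realz: "F (of_real s) = 0" for s
  proof -
    have *: "(\<integral>x. exp (of_real s * complex_of_real x) \<partial>Q)
        = of_real (enn2real (\<integral>\<^sup>+x. ennreal (exp (s * x)) \<partial>Q))"
      if [measurable_cong]: "sets Q = sets borel" for Q :: "real measure"
    proof -
      have "(\<integral>x. exp (of_real s * complex_of_real x) \<partial>Q) = (\<integral>x. complex_of_real (exp (s * x)) \<partial>Q)"
        by (simp add: exp_of_real flip: of_real_mult)
      also have "\<dots> = of_real (\<integral>x. exp (s * x) \<partial>Q)"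
        by (rule integral_complex_of_real)
      also have "(\<integral>x. exp (s * x) \<partial>Q) = enn2real (\<integral>\<^sup>+x. ennreal (exp (s * x)) \<partial>Q)"
        by (rule integral_eq_nn_integral) auto
      finally show ?thesis .
    qed
    show ?thesis
      unfolding F_def *[OF sM] *[OF sN] eq by simp
  qed
  have Fz: "F z = 0" for z
  proof (rule analytic_continuation[OF hol open_UNIV connected_UNIV subset_UNIV UNIV_I])
    show "(0::complex) islimpt \<real>"
      unfolding islimpt_approachable
    proof (intro allI impI)
      fix e :: real assume "0 < e"
      then show "\<exists>x'\<in>\<real>. x' \<noteq> (0::complex) \<and> dist x' 0 < e"
        by (intro bexI[of _ "of_real (e / 2)"]) (auto simp: norm_divide)
    qed
  qed (auto elim!: Reals_cases simp: realz)
  \<comment> \<open>The uniqueness theorem is about probability measures; \<open>c\<close> is the mass to divide out, unless it is 0.\<close>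
  define c where "c = emeasure M UNIV"
  have cN: "c = emeasure N UNIV" and cfin: "c < \<infinity>"
    using eq[of 0] fin[of 0] by (simp_all add: c_def spM spN)
  show ?thesis
  proof (cases "c = 0")
    case True
    have "emeasure M A = 0" "emeasure N A = 0" for A
      using emeasure_space[of M A] emeasure_space[of N A] True cN by (simp_all add: c_def spM spN)
    then show ?thesis
      using sM sN by (intro measure_eqI) auto
  next
    case False
    define r where "r = enn2real c"
    have r: "c = ennreal r" "r > 0"
      using cfin False by (auto simp: r_def enn2real_positive_iff less_top zero_less_iff_neq_zero)
    let ?n = "\<lambda>Q :: real measure. scale_measure (ennreal (1 / r)) Q"
    have ps: "real_distribution (?n Q)" if "sets Q = sets borel" "emeasure Q UNIV = c" for Q
    proof -
      have "prob_space (?n Q)"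
        using that r sets_eq_imp_space_eq[OF that(1)]
        by (intro prob_spaceI) (simp add: space_scale_measure flip: ennreal_mult')
      then show ?thesis
        using that by (simp add: real_distribution_def real_distribution_axioms_def)
    qed
    have nd: "?n Q = density Q (\<lambda>_. ennreal (1 / r))" for Q
      by (rule measure_eqI) (auto simp: emeasure_density nn_integral_cmult_indicator)
    have ch: "char (?n Q) t = (1 / r) *\<^sub>R (\<integral>x. exp (\<i> * of_real t * complex_of_real x) \<partial>Q)"
      if [measurable_cong]: "sets Q = sets borel" for Q t
      unfolding char_def nd using r
      by (subst integral_density) (auto simp: mult.assoc)
    have "?n M = ?n N"
    proof (rule Levy_uniqueness[OF ps ps])
      show "char (?n M) = char (?n N)"
        using Fz unfolding F_def by (simp add: ch[OF sM] ch[OF sN] fun_eq_iff)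
    qed (use sM sN cN c_def in auto)
    then have "scale_measure (ennreal r) (?n M) = scale_measure (ennreal r) (?n N)"
      by simp
    then show ?thesis
      using r by (simp flip: ennreal_mult')
  qed
qed

text \<open>
  A device that reduces several dimensions to one: in the integrand \<open>exp (t \<bullet> z)\<close> the exponential in one
  coordinate after the other is replaced by the indicator of a Borel set.  A replacement step is
  the one-dimensional uniqueness theorem for the image, under the coordinate concerned, of the
  measure weighted by all remaining factors.  In the end the measures agree on boxes.
\<close>

lemma measure_eqI_mgf:
  fixes M N :: "'a::euclidean_space measure"
  assumes sM: "sets M = sets borel" and sN: "sets N = sets borel"
    and eq: "\<And>t. (\<integral>\<^sup>+z. ennreal (exp (t \<bullet> z)) \<partial>M) = (\<integral>\<^sup>+z. ennreal (exp (t \<bullet> z)) \<partial>N)"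
    and fin: "\<And>t. (\<integral>\<^sup>+z. ennreal (exp (t \<bullet> z)) \<partial>M) < \<infinity>"
  shows "M = N"
proof -
  note [measurable_cong] = sM sN
  have boxes: "(\<integral>\<^sup>+z. indicator {z. \<forall>i\<in>S. z \<bullet> i \<in> B i} z * ennreal (exp (t \<bullet> z)) \<partial>M)
      = (\<integral>\<^sup>+z. indicator {z. \<forall>i\<in>S. z \<bullet> i \<in> B i} z * ennreal (exp (t \<bullet> z)) \<partial>N)"
    if "finite S" and B: "\<And>i. B i \<in> sets borel" for S :: "'a set" and B t
    using that(1)
  proof (induction S arbitrary: t)
    case empty
    then show ?case using eq by simp
  next
    case (insert j S)
    have [measurable]: "B i \<in> sets borel" for i by (rule B)
    have [measurable]: "{z. \<forall>i\<in>S. z \<bullet> i \<in> B i} \<in> sets borel"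
      using insert.hyps(1) by measurable
    \<comment> \<open>Varying \<open>s\<close> below moves \<open>t\<close> along \<open>j\<close>, which is why the induction is for arbitrary \<open>t\<close>.\<close>
    define h where "h z = indicator {z. \<forall>i\<in>S. z \<bullet> i \<in> B i} z * ennreal (exp (t \<bullet> z))" for z
    have [measurable]: "h \<in> borel_measurable borel"
      unfolding h_def by measurable
    have mgf: "(\<integral>\<^sup>+x. ennreal (exp (s * x)) \<partial>distr (density Q h) borel (\<lambda>z. z \<bullet> j))
        = (\<integral>\<^sup>+z. indicator {z. \<forall>i\<in>S. z \<bullet> i \<in> B i} z * ennreal (exp ((t + s *\<^sub>R j) \<bullet> z)) \<partial>Q)"
      if [measurable_cong]: "sets Q = sets borel" for Q s
      by (subst nn_integral_distr, simp, simp, subst nn_integral_density)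
         (auto intro!: nn_integral_cong simp: h_def mult.assoc inner_add_left inner_commute[of j] exp_add
               simp flip: ennreal_mult')
    have "distr (density M h) borel (\<lambda>z. z \<bullet> j) = distr (density N h) borel (\<lambda>z. z \<bullet> j)"
    proof (rule measure_eqI_mgf_real)
      fix s :: real
      show "(\<integral>\<^sup>+x. ennreal (exp (s * x)) \<partial>distr (density M h) borel (\<lambda>z. z \<bullet> j))
          = (\<integral>\<^sup>+x. ennreal (exp (s * x)) \<partial>distr (density N h) borel (\<lambda>z. z \<bullet> j))"
        unfolding mgf[OF sM] mgf[OF sN] by (rule insert.IH)
      have "(\<integral>\<^sup>+x. ennreal (exp (s * x)) \<partial>distr (density M h) borel (\<lambda>z. z \<bullet> j))
          \<le> (\<integral>\<^sup>+z. ennreal (exp ((t + s *\<^sub>R j) \<bullet> z)) \<partial>M)"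
        unfolding mgf[OF sM] by (intro nn_integral_mono) (auto split: split_indicator)
      also have "\<dots> < \<infinity>" by (rule fin)
      finally show "(\<integral>\<^sup>+x. ennreal (exp (s * x)) \<partial>distr (density M h) borel (\<lambda>z. z \<bullet> j)) < \<infinity>" .
    qed simp_all
    then have "emeasure (distr (density M h) borel (\<lambda>z. z \<bullet> j)) (B j)
        = emeasure (distr (density N h) borel (\<lambda>z. z \<bullet> j)) (B j)"
      by simp
    moreover have "emeasure (distr (density Q h) borel (\<lambda>z. z \<bullet> j)) (B j)
        = (\<integral>\<^sup>+z. indicator {z. \<forall>i\<in>insert j S. z \<bullet> i \<in> B i} z * ennreal (exp (t \<bullet> z)) \<partial>Q)"
      if [measurable_cong]: "sets Q = sets borel" for Q
    proof -
      have "emeasure (distr (density Q h) borel (\<lambda>z. z \<bullet> j)) (B j)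
          = (\<integral>\<^sup>+z. indicator (B j) z \<partial>distr (density Q h) borel (\<lambda>z. z \<bullet> j))"
        by simp
      also have "\<dots> = (\<integral>\<^sup>+z. h z * indicator (B j) (z \<bullet> j) \<partial>Q)"
        by (subst nn_integral_distr, simp, simp, subst nn_integral_density) auto
      finally show ?thesis
        by (auto intro!: nn_integral_cong simp: h_def split: split_indicator)
    qed
    ultimately show ?case using sM sN by simp
  qed
  have cube: "emeasure M (box a b) = emeasure N (box a b)" for a b
  proof -
    let ?B = "\<lambda>i. {a \<bullet> i <..< b \<bullet> i}"
    have eqb: "{z. \<forall>i\<in>Basis. z \<bullet> i \<in> ?B i} = box a b"
      by (auto simp: box_def)
    show ?thesis
      using boxes[of Basis ?B 0] unfolding eqb by simp
  qed
  have total: "emeasure M UNIV < \<infinity>"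
    using fin[of 0] sets_eq_imp_space_eq[OF sM] by simp
  have finM: "emeasure M A \<noteq> \<infinity>" for A
    using le_less_trans[OF emeasure_space total[folded sets_eq_imp_space_eq[OF sM, simplified]], of A]
    by simp
  show ?thesis
  proof (rule measure_eqI_generator_eq)
    show "Int_stable (range (\<lambda>(a, b). box a b :: 'a set))"
      by (auto simp: Int_stable_def box_Int_box)
    show "range (\<lambda>n::nat. box (- (real n *\<^sub>R One)) (real n *\<^sub>R One) :: 'a set)
        \<subseteq> range (\<lambda>(a, b). box a b)"
      by auto
    show "(\<Union>n::nat. box (- (real n *\<^sub>R One)) (real n *\<^sub>R One) :: 'a set) = UNIV"
      by (rule UN_box_eq_UNIV)
      show "emeasure M (box (- (real n *\<^sub>R One)) (real n *\<^sub>R One)) \<noteq> \<infinity>" for n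
      by (rule finM)
  qed (use cube sM sN in \<open>auto simp: borel_eq_box\<close>)
qed

section \<open>Positive semi-definite matrices and a measurable square root\<close>

lemma vec_nth_borel_measurable [measurable (raw)]:
  fixes f :: "'a \<Rightarrow> 'b::second_countable_topology ^ 'n"
  shows "f \<in> borel_measurable M \<Longrightarrow> (\<lambda>x. f x $ i) \<in> borel_measurable M"
  by (rule borel_measurable_continuous_on[of "\<lambda>v. v $ i"]) (intro continuous_intros)

lemma vec_lambda_borel_measurable [measurable (raw)]:
  fixes f :: "'a \<Rightarrow> 'n::finite \<Rightarrow> 'b::euclidean_space"
  assumes "\<And>i. (\<lambda>x. f x i) \<in> borel_measurable M"
  shows "(\<lambda>x. \<chi> i. f x i) \<in> borel_measurable M"
  using assms by (auto simp: borel_measurable_euclidean_space[where 'c="'b ^ 'n"] Basis_vec_def inner_axis)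

lemma matrix_vector_mult_borel_measurable [measurable (raw)]:
  fixes f :: "'a \<Rightarrow> real ^ 'n ^ 'm"
  assumes [measurable]: "f \<in> borel_measurable M" "g \<in> borel_measurable M"
  shows "(\<lambda>x. f x *v g x) \<in> borel_measurable M"
  unfolding matrix_vector_mult_def by measurable

lemma psd_diag_nonneg: "psd V \<Longrightarrow> 0 \<le> V $ j $ j"
  unfolding psd_def by (auto dest!: spec[of _ "axis j 1"] simp: inner_axis' matrix_vector_mult_basis column_def)

lemma psd_symmetric: "psd V \<Longrightarrow> V $ i $ j = V $ j $ i"
  unfolding psd_def transpose_def by (metis vec_lambda_beta)

text \<open>
  The quadratic form is nonnegative along the line \<open>v + s e\<^sub>j\<close>, so its discriminant in \<open>s\<close> is not positive.
\<close>

lemma psd_cauchy_schwarz: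
  assumes "psd V"
  shows "(v \<bullet> column j V)\<^sup>2 \<le> V $ j $ j * (v \<bullet> (V *v v))"
proof -
  define q c d where "q = v \<bullet> (V *v v)" and "c = v \<bullet> column j V" and "d = V $ j $ j"
  have nonneg: "0 \<le> q + 2 * s * c + s\<^sup>2 * d" for s
  proof -
    have "axis j 1 \<bullet> (V *v v) = (\<Sum>i\<in>UNIV. V $ j $ i * v $ i)"
      by (simp add: inner_axis' matrix_vector_mult_def)
    also have "\<dots> = (\<Sum>i\<in>UNIV. v $ i * V $ i $ j)"
      by (rule sum.cong) (simp_all add: psd_symmetric[OF assms, of j])
    also have "\<dots> = c"
      by (simp add: c_def inner_vec_def column_def)
    finally have sym: "axis j 1 \<bullet> (V *v v) = c" .
    have "0 \<le> (v + s *\<^sub>R axis j 1) \<bullet> (V *v (v + s *\<^sub>R axis j 1))"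
      using assms by (simp add: psd_def)
    also have "\<dots> = q + s * c + s * (axis j 1 \<bullet> (V *v v)) + s\<^sup>2 * d"
      by (simp add: matrix_vector_right_distrib scaleR_matrix_vector_assoc[symmetric] matrix_vector_mult_scaleR
        matrix_vector_mult_basis inner_add_left inner_add_right q_def c_def d_def power2_eq_square inner_axis' column_def algebra_simps)
    finally show ?thesis unfolding sym by (simp add: algebra_simps)
  qed
  have "d \<ge> 0" using psd_diag_nonneg[OF assms] by (simp add: d_def)
  show "c\<^sup>2 \<le> d * q"
  proof (cases "d = 0")
    case True
    \<comment> \<open>A nonconstant affine function of \<open>s\<close> takes the value -1.\<close>
    then have "c = 0"
      using nonneg[of "- (q + 1) / (2 * c)"] by (cases "c = 0") (auto simp: field_simps)
    then show ?thesis using True by simp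
  next
    case False
    then have "0 \<le> d * (q + 2 * (- c / d) * c + (- c / d)\<^sup>2 * d)"
      using nonneg[of "- c / d"] \<open>d \<ge> 0\<close> by simp
    also have "\<dots> = d * q - c\<^sup>2"
      using False by (simp add: field_simps power2_eq_square)
    finally show ?thesis by simp
  qed
qed

text \<open>
  The Schur complement of the pivot \<open>j\<close>, kept at full size.  If the pivot of a positive semi-definite
  matrix vanishes, then so do its row and column, and since \<open>x / 0 = 0\<close> the formula then changes nothing.
\<close>

definition eliminate :: "'n::finite \<Rightarrow> real ^ 'n ^ 'n \<Rightarrow> real ^ 'n ^ 'n" where
  "eliminate j V = (\<chi> i k. V $ i $ k - V $ i $ j * V $ k $ j / V $ j $ j)"

lemma psd_eliminate:
  assumes "psd V"
  shows "psd (eliminate j V)"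
proof -
  let ?d = "V $ j $ j"
  have "v \<bullet> (eliminate j V *v v) = v \<bullet> (V *v v) - (v \<bullet> column j V)\<^sup>2 / ?d" for v
    by (simp add: eliminate_def inner_vec_def matrix_vector_mult_def column_def power2_eq_square
        sum_product sum_distrib_left sum_divide_distrib left_diff_distrib right_diff_distrib
        sum_subtractf mult_ac)
  moreover have "(v \<bullet> column j V)\<^sup>2 / ?d \<le> v \<bullet> (V *v v)" for v
    using psd_cauchy_schwarz[OF assms, of v j] psd_diag_nonneg[OF assms, of j] assms
    by (cases "?d = 0") (auto simp: psd_def field_simps)
  moreover have "transpose (eliminate j V) = eliminate j V"
    using psd_symmetric[OF assms] by (auto simp: eliminate_def transpose_def vec_eq_iff)
  ultimately show ?thesis by (simp add: psd_def)
qed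

lemma eliminate_row_zero:
  assumes "psd V"
  shows "eliminate j V $ j $ k = 0"
proof (cases "V $ j $ j = 0")
  case True
  have "(axis k 1 \<bullet> column j V)\<^sup>2 \<le> 0"
    using psd_cauchy_schwarz[OF assms, of "axis k 1" j] True by simp
  then have "V $ k $ j = 0"
    by (simp add: inner_axis' column_def)
  then show ?thesis using True psd_symmetric[OF assms, of k j] by (simp add: eliminate_def)
next
  case False
  then show ?thesis using psd_symmetric[OF assms, of k j] by (simp add: eliminate_def)
qed

text \<open>
  Square roots by elimination, with pivots taken in the order of the list; column \<open>j\<close> of the result is the
  rank one factor split off at pivot \<open>j\<close>.  Unlike the symmetric square root, this factor is an explicit
  formula in the entries, so that its measurability is evident.
\<close>

fun cholesky :: "'n::finite list \<Rightarrow> real ^ 'n ^ 'n \<Rightarrow> real ^ 'n ^ 'n" where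
  "cholesky [] V = 0"
| "cholesky (j # js) V =
    (\<chi> i k. if k = j then V $ i $ j / sqrt (V $ j $ j) else cholesky js (eliminate j V) $ i $ k)"

lemma cholesky_column_zero: "k \<notin> set js \<Longrightarrow> cholesky js V $ i $ k = 0"
  by (induction js V rule: cholesky.induct) auto

text \<open>
  The hypothesis on rows is the invariant of elimination: rows outside the list have already been cleared.
\<close>

lemma cholesky_mult_transpose:
  assumes "psd V" "distinct js" "\<And>i k. i \<notin> set js \<Longrightarrow> V $ i $ k = 0"
  shows "cholesky js V ** transpose (cholesky js V) = V"
  using assms
proof (induction js arbitrary: V)
  case Nil
  then show ?case by (simp add: vec_eq_iff)
next
  case (Cons j js)
  let ?V = "eliminate j V" and ?C = "cholesky js (eliminate j V)"
  have zero: "?V $ i $ k = 0" if "i \<notin> set js" for i k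
    using that Cons.prems(3)[of i] eliminate_row_zero[OF Cons.prems(1), of j k]
    by (cases "i = j") (auto simp: eliminate_def)
  have IH: "?C ** transpose ?C = ?V"
    using Cons.prems zero by (intro Cons.IH psd_eliminate) auto
  show ?case
  proof (simp only: vec_eq_iff, intro allI)
    fix i l
    let ?D = "cholesky (j # js) V"
    have "(?D ** transpose ?D) $ i $ l = (\<Sum>k\<in>UNIV. ?D $ i $ k * ?D $ l $ k)"
      by (simp add: matrix_matrix_mult_def transpose_def)
    also have "\<dots> = ?D $ i $ j * ?D $ l $ j + (\<Sum>k\<in>UNIV - {j}. ?D $ i $ k * ?D $ l $ k)"
      by (rule sum.remove) auto
    also have "(\<Sum>k\<in>UNIV - {j}. ?D $ i $ k * ?D $ l $ k) = (\<Sum>k\<in>UNIV - {j}. ?C $ i $ k * ?C $ l $ k)"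
      by (rule sum.cong) auto
    also have "\<dots> = (\<Sum>k\<in>UNIV. ?C $ i $ k * ?C $ l $ k)"
      using cholesky_column_zero[of j js] Cons.prems(2) by (intro sum.mono_neutral_left) auto
    also have "\<dots> = (?C ** transpose ?C) $ i $ l"
      by (simp add: matrix_matrix_mult_def transpose_def)
    also have "\<dots> = ?V $ i $ l"
      unfolding IH ..
    also have "?D $ i $ j * ?D $ l $ j = V $ i $ j * V $ l $ j / V $ j $ j"
      using psd_diag_nonneg[OF Cons.prems(1), of j] by simp
    finally show "(?D ** transpose ?D) $ i $ l = V $ i $ l"
      by (simp add: eliminate_def)
  qed
qed

lemma cholesky_borel_measurable: "cholesky js \<in> borel_measurable borel"
proof (induction js)
  case (Cons j js)
  note [measurable] = Cons
  have [measurable]: "eliminate j \<in> borel_measurable borel"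
    unfolding eliminate_def[abs_def] by measurable
  show ?case by simp
qed simp

lemma measurable_psd_root:
  obtains R :: "real ^ 'n ^ 'n \<Rightarrow> real ^ 'n ^ 'n"
  where "R \<in> borel_measurable borel" "\<And>V. psd V \<Longrightarrow> R V ** transpose (R V) = V"
proof -
  obtain js :: "'n list" where "set js = UNIV" "distinct js"
    using finite_distinct_list[OF finite_class.finite_UNIV] by blast
  then show ?thesis
    by (intro that[of "cholesky js"] cholesky_borel_measurable cholesky_mult_transpose) auto
qed

lemma closed_psd: "closed {V. psd V}"
proof -
  have "{V. psd V} = {V. transpose V = V} \<inter> (\<Inter>v. {V. 0 \<le> v \<bullet> (V *v v)})"
    by (auto simp: psd_def)
  also have "closed \<dots>"
    unfolding transpose_def matrix_vector_mult_def inner_vec_def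
    by (intro closed_Int closed_INT ballI closed_Collect_eq closed_Collect_le continuous_intros)
  finally show ?thesis .
qed

section \<open>The multivariate normal law\<close>

text \<open>
  Completing the square: tilting the standard normal density by \<open>exp (s x)\<close> shifts its mean to \<open>s\<close>.
\<close>

lemma nn_integral_exp_std_normal:
  "(\<integral>\<^sup>+x. ennreal (exp (s * x)) \<partial>std_normal_distribution) = ennreal (exp (s\<^sup>2 / 2))"
proof -
  have "(\<integral>\<^sup>+x. ennreal (exp (s * x)) \<partial>std_normal_distribution)
      = (\<integral>\<^sup>+x. ennreal (std_normal_density x) * ennreal (exp (s * x)) \<partial>lborel)"
    by (rule nn_integral_density) auto
  also have "\<dots> = (\<integral>\<^sup>+x. ennreal (exp (s\<^sup>2 / 2)) * ennreal (normal_density s 1 x) \<partial>lborel)"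
  proof (rule nn_integral_cong)
    fix x :: real
    have "std_normal_density x * exp (s * x) = exp (s\<^sup>2 / 2) * normal_density s 1 x"
      by (simp add: normal_density_def field_simps power2_eq_square flip: exp_add)
    then show "ennreal (std_normal_density x) * ennreal (exp (s * x))
        = ennreal (exp (s\<^sup>2 / 2)) * ennreal (normal_density s 1 x)"
      by (simp flip: ennreal_mult')
  qed
  also have "\<dots> = ennreal (exp (s\<^sup>2 / 2)) * (\<integral>\<^sup>+x. ennreal (normal_density s 1 x) \<partial>lborel)"
    by (rule nn_integral_cmult) simp
  also have "(\<integral>\<^sup>+x. ennreal (normal_density s 1 x) \<partial>lborel) = 1"
    using prob_space.emeasure_space_1[OF prob_space_normal_density[of 1 s]]
    by (simp add: emeasure_density)
  finally show ?thesis by simp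
qed

lemma std_mvn_measurable_vec:
  "(\<lambda>w. \<chi> i. w i) \<in> borel_measurable (PiM UNIV (\<lambda>_. std_normal_distribution))"
  by measurable

lemma prob_space_std_mvn: "prob_space std_mvn"
proof -
  interpret std: prob_space std_normal_distribution
    by (rule prob_space_normal_density) simp
  interpret product_prob_space "\<lambda>_. std_normal_distribution" UNIV ..
  show ?thesis
    unfolding std_mvn_def by (rule prob_space_distr) (rule std_mvn_measurable_vec)
qed

lemma sets_std_mvn [measurable_cong]: "sets std_mvn = sets borel"
  by (simp add: std_mvn_def)

lemma nn_integral_exp_std_mvn:
  "(\<integral>\<^sup>+w. ennreal (exp (t \<bullet> w)) \<partial>std_mvn) = ennreal (exp ((t \<bullet> t) / 2))"
proof -
  interpret std: prob_space std_normal_distribution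
    by (rule prob_space_normal_density) simp
  interpret product_prob_space "\<lambda>_. std_normal_distribution" UNIV ..
  note [measurable] = std_mvn_measurable_vec
  have "(\<integral>\<^sup>+w. ennreal (exp (t \<bullet> w)) \<partial>std_mvn)
      = (\<integral>\<^sup>+w. (\<Prod>i\<in>UNIV. ennreal (exp (t $ i * w i))) \<partial>(PiM UNIV (\<lambda>_. std_normal_distribution)))"
    unfolding std_mvn_def
    by (subst nn_integral_distr) (auto intro!: nn_integral_cong simp: inner_vec_def exp_sum prod_ennreal)
  also have "\<dots> = (\<Prod>i\<in>UNIV. ennreal (exp ((t $ i)\<^sup>2 / 2)))"
    by (subst product_nn_integral_prod) (auto simp: nn_integral_exp_std_normal)
  also have "\<dots> = ennreal (exp ((t \<bullet> t) / 2))"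
    by (simp add: prod_ennreal inner_vec_def sum_divide_distrib power2_eq_square flip: exp_sum)
  finally show ?thesis .
qed

lemma nn_integral_exp_affine_std_mvn:
  "(\<integral>\<^sup>+z. ennreal (exp (t \<bullet> z)) \<partial>distr std_mvn borel (\<lambda>w. m + A *v w))
    = ennreal (exp (t \<bullet> m + (t \<bullet> ((A ** transpose A) *v t)) / 2))"
proof -
  have adj: "t \<bullet> (A *v w) = (transpose A *v t) \<bullet> w" for w
    by (simp add: transpose_matrix_vector dot_lmul_matrix)
  have "(\<integral>\<^sup>+z. ennreal (exp (t \<bullet> z)) \<partial>distr std_mvn borel (\<lambda>w. m + A *v w))
      = (\<integral>\<^sup>+w. ennreal (exp (t \<bullet> m)) * ennreal (exp ((transpose A *v t) \<bullet> w)) \<partial>std_mvn)"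
    by (subst nn_integral_distr) (auto intro!: nn_integral_cong simp: inner_add_right adj exp_add ennreal_mult')
  also have "\<dots> = ennreal (exp (t \<bullet> m)) * ennreal (exp (((transpose A *v t) \<bullet> (transpose A *v t)) / 2))"
    by (subst nn_integral_cmult) (auto simp: nn_integral_exp_std_mvn)
  also have "(transpose A *v t) \<bullet> (transpose A *v t) = t \<bullet> ((A ** transpose A) *v t)"
    by (simp only: adj[symmetric] matrix_vector_mul_assoc)
  finally show ?thesis
    by (simp add: exp_add flip: ennreal_mult')
qed

lemma psd_has_root:
  fixes V :: "real ^ 'n ^ 'n"
  assumes "psd V"
  obtains A :: "real ^ 'n ^ 'n" where "A ** transpose A = V"
proof -
  obtain R :: "real ^ 'n ^ 'n \<Rightarrow> real ^ 'n ^ 'n"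
    where "\<And>V. psd V \<Longrightarrow> R V ** transpose (R V) = V"
    using measurable_psd_root by blast
  then show ?thesis using assms that by blast
qed

text \<open>
  The moment generating function of \<open>m + A W\<close> involves \<open>A\<close> only through \<open>A A' = V\<close>, so every root of \<open>V\<close> may
  stand in for the one picked by the choice operator.
\<close>

lemma mvn_eq_distr_root:
  fixes V A :: "real ^ 'n ^ 'n"
  assumes "psd V" and "A ** transpose A = V"
  shows "mvn m V = distr std_mvn borel (\<lambda>w. m + A *v w)"
proof -
  define A0 where "A0 = (SOME A :: real ^ 'n ^ 'n. A ** transpose A = V)"
  have A0: "A0 ** transpose A0 = V"
    unfolding A0_def using assms(2) by (rule someI)
  have "mvn m V = distr std_mvn borel (\<lambda>w. m + A0 *v w)"
    using assms(1) by (simp add: mvn_def A0_def)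
  also have "\<dots> = distr std_mvn borel (\<lambda>w. m + A *v w)"
    by (rule measure_eqI_mgf) (simp_all add: nn_integral_exp_affine_std_mvn A0 assms(2))
  finally show ?thesis .
qed

lemma mgf_mvn:
  fixes V :: "real ^ 'n ^ 'n"
  assumes "psd V"
  shows "(\<integral>\<^sup>+z. ennreal (exp (t \<bullet> z)) \<partial>mvn m V) = ennreal (exp (t \<bullet> m + (t \<bullet> (V *v t)) / 2))"
proof -
  obtain A :: "real ^ 'n ^ 'n" where "A ** transpose A = V" using psd_has_root[OF assms] .
  then show ?thesis
    using mvn_eq_distr_root[OF assms] nn_integral_exp_affine_std_mvn by metis
qed

text \<open>
  The root picked by the choice operator need not depend measurably on the variance matrix, but the
  law is the same for the measurable root obtained by elimination.
\<close>

lemma mvn_measurable [measurable (raw)]: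
  fixes V :: "'a \<Rightarrow> real ^ 'n ^ 'n"
  assumes [measurable]: "m \<in> borel_measurable M" "V \<in> borel_measurable M"
  shows "(\<lambda>x. mvn (m x) (V x)) \<in> M \<rightarrow>\<^sub>M prob_algebra borel"
proof -
  obtain R :: "real ^ 'n ^ 'n \<Rightarrow> real ^ 'n ^ 'n"
    where R[measurable]: "R \<in> borel_measurable borel" and root: "\<And>V. psd V \<Longrightarrow> R V ** transpose (R V) = V"
    using measurable_psd_root by blast
  have [measurable]: "Measurable.pred borel (psd :: real ^ 'n ^ 'n \<Rightarrow> bool)"
    using borel_closed[OF closed_psd] by (simp add: pred_def)
  have [measurable]: "(\<lambda>x. std_mvn) \<in> M \<rightarrow>\<^sub>M prob_algebra borel"
    by (rule measurable_const) (simp add: space_prob_algebra prob_space_std_mvn sets_std_mvn)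
  have "(\<lambda>x. if psd (V x) then distr std_mvn borel (\<lambda>w. m x + R (V x) *v w) else return borel (m x))
      \<in> M \<rightarrow>\<^sub>M prob_algebra borel"
    by (intro measurable_If measurable_distr_prob_space2[where M=borel]
        measurable_compose[OF _ measurable_return_prob_space]) measurable
  moreover have "mvn (m x) (V x)
      = (if psd (V x) then distr std_mvn borel (\<lambda>w. m x + R (V x) *v w) else return borel (m x))" for x
    using mvn_eq_distr_root[OF _ root, of "V x"] by (auto simp: mvn_def)
  ultimately show ?thesis by simp
qed

text \<open>
  A Gaussian shift model integrates to one.  With \<open>m = K \<theta>\<close> and \<open>V = K\<close> the integrand is the likelihood ratio
  between \<open>\<theta> + t\<close> and \<open>\<theta>\<close>, so this says that the ratio has conditional mean one given \<open>K\<close>.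
\<close>

lemma nn_integral_likelihood_ratio_mvn:
  fixes V :: "real ^ 'n ^ 'n"
  assumes "psd V"
  shows "(\<integral>\<^sup>+z. ennreal (exp (t \<bullet> (z - m) - (t \<bullet> (V *v t)) / 2)) \<partial>mvn m V) = 1"
proof -
  have [measurable_cong]: "sets (mvn m V) = sets borel"
    by (simp add: mvn_def)
  let ?c = "- (t \<bullet> m) - (t \<bullet> (V *v t)) / 2"
  have "(\<integral>\<^sup>+z. ennreal (exp (t \<bullet> (z - m) - (t \<bullet> (V *v t)) / 2)) \<partial>mvn m V)
      = (\<integral>\<^sup>+z. ennreal (exp ?c) * ennreal (exp (t \<bullet> z)) \<partial>mvn m V)"
    by (rule nn_integral_cong) (simp add: inner_diff_right flip: ennreal_mult' exp_add)
  also have "\<dots> = ennreal (exp ?c) * ennreal (exp (t \<bullet> m + (t \<bullet> (V *v t)) / 2))"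
    by (subst nn_integral_cmult) (simp_all add: mgf_mvn[OF assms])
  also have "\<dots> = 1"
    by (simp flip: ennreal_mult' exp_add)
  finally show ?thesis .
qed


section \<open>Conditional distributions as disintegrations\<close>

lemma subalgebra_vimage_algebra:
  "K \<in> M \<rightarrow>\<^sub>M L \<Longrightarrow> subalgebra M (vimage_algebra (space M) K L)"
  using sets_image_in_sets[OF refl, of K M L] by (simp add: subalgebra_def)

lemma set_integral_indicator_eq_measure:
  assumes [measurable]: "Z \<in> M \<rightarrow>\<^sub>M N" "K \<in> M \<rightarrow>\<^sub>M L" "A \<in> sets L" "B \<in> sets N"
  shows "(\<integral>x\<in>K -` A \<inter> space M. indicator B (Z x) \<partial>M) = measure M {x \<in> space M. K x \<in> A \<and> Z x \<in> B}"
proof -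
  have "(\<integral>x\<in>K -` A \<inter> space M. indicator B (Z x) \<partial>M)
      = (\<integral>x. indicator {x \<in> space M. K x \<in> A \<and> Z x \<in> B} x \<partial>M)"
    unfolding set_lebesgue_integral_def by (rule Bochner_Integration.integral_cong) (auto split: split_indicator)
  also have "\<dots> = measure M ({x \<in> space M. K x \<in> A \<and> Z x \<in> B} \<inter> space M)"
    by simp
  finally show ?thesis by (simp add: Int_absorb2)
qed

lemma integrable_measure_kernel:
  assumes "prob_space M" and [measurable]: "K \<in> M \<rightarrow>\<^sub>M L" "\<kappa> \<in> L \<rightarrow>\<^sub>M prob_algebra N" "B \<in> sets N"
  shows "integrable M (\<lambda>x. measure (\<kappa> (K x)) B)"
proof -
  interpret prob_space M by fact
  have "(\<lambda>x. measure (\<kappa> (K x)) B) \<in> borel_measurable M"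
    using measure_measurable_prob_algebra2[of L "\<lambda>_. B" N \<kappa>]
    by (intro measurable_compose[OF assms(2)]) auto
  moreover have "norm (measure (\<kappa> (K x)) B) \<le> 1" if "x \<in> space M" for x
  proof -
    have "\<kappa> (K x) \<in> space (prob_algebra N)"
      using that by (meson assms(2,3) measurable_space)
    then interpret \<kappa>: prob_space "\<kappa> (K x)"
      by (simp add: space_prob_algebra)
    show ?thesis by simp
  qed
  ultimately show ?thesis
    by (intro integrable_const_bound[where B=1] AE_I2) auto
qed

lemma set_integral_kernel_eq_nn_integral:
  assumes M: "prob_space M" and [measurable]: "K \<in> M \<rightarrow>\<^sub>M L" "\<kappa> \<in> L \<rightarrow>\<^sub>M prob_algebra N" "A \<in> sets L" "B \<in> sets N"
  shows "ennreal (\<integral>x\<in>K -` A \<inter> space M. measure (\<kappa> (K x)) B \<partial>M)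
    = (\<integral>\<^sup>+x. indicator A (K x) * emeasure (\<kappa> (K x)) B \<partial>M)"
proof -
  have "(\<integral>\<^sup>+x. indicator A (K x) * emeasure (\<kappa> (K x)) B \<partial>M)
      = (\<integral>\<^sup>+x. ennreal (indicator (K -` A \<inter> space M) x *\<^sub>R measure (\<kappa> (K x)) B) \<partial>M)"
  proof (rule nn_integral_cong)
    fix x assume x: "x \<in> space M"
    then have "\<kappa> (K x) \<in> space (prob_algebra N)"
      by (meson assms(2,3) measurable_space)
    then interpret \<kappa>: prob_space "\<kappa> (K x)"
      by (simp add: space_prob_algebra)
    show "indicator A (K x) * emeasure (\<kappa> (K x)) B
        = ennreal (indicator (K -` A \<inter> space M) x *\<^sub>R measure (\<kappa> (K x)) B)"
      using x by (simp add: \<kappa>.emeasure_eq_measure split: split_indicator)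
  qed
  also have "\<dots> = ennreal (\<integral>x\<in>K -` A \<inter> space M. measure (\<kappa> (K x)) B \<partial>M)"
    unfolding set_lebesgue_integral_def
  proof (rule nn_integral_eq_integral)
    show "integrable M (\<lambda>x. indicator (K -` A \<inter> space M) x *\<^sub>R measure (\<kappa> (K x)) B)"
      by (rule integrable_mult_indicator[OF _ integrable_measure_kernel[OF M]]) measurable
  qed auto
  finally show ?thesis by simp
qed

text \<open>
  Conditional probabilities are characterised by their integrals over the events \<open>K \<in> A\<close>, which generate,
  and even exhaust, the sigma-algebra of \<open>K\<close>.  This form is free of exceptional null sets.
\<close>

lemma cond_distribution_iff_rectangles:
  assumes M: "prob_space M" and Z[measurable]: "Z \<in> M \<rightarrow>\<^sub>M N" and K[measurable]: "K \<in> M \<rightarrow>\<^sub>M L"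
    and \<kappa>[measurable]: "\<kappa> \<in> L \<rightarrow>\<^sub>M prob_algebra N"
  shows "cond_distribution M N Z L K \<kappa> \<longleftrightarrow>
    (\<forall>A\<in>sets L. \<forall>B\<in>sets N. emeasure M {x \<in> space M. K x \<in> A \<and> Z x \<in> B}
      = (\<integral>\<^sup>+x. indicator A (K x) * emeasure (\<kappa> (K x)) B \<partial>M))"
proof -
  let ?F = "vimage_algebra (space M) K L"
  interpret prob_space M by fact
  interpret finite_measure_subalgebra M ?F
    by unfold_locales (rule subalgebra_vimage_algebra[OF K])
  have F: "sets ?F = {K -` A \<inter> space M | A. A \<in> sets L}"
    by (rule sets_vimage_algebra2) (use measurable_space[OF K] in auto)
  have intZ: "integrable M (\<lambda>x. indicator B (Z x) :: real)" if [measurable]: "B \<in> sets N" for B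
    by (rule integrable_const_bound[where B=1]) (auto split: split_indicator)
  have intk: "integrable M (\<lambda>x. measure (\<kappa> (K x)) B)" if "B \<in> sets N" for B
    by (rule integrable_measure_kernel[OF M K \<kappa> that])
  have rect: "(\<integral>x\<in>K -` A \<inter> space M. indicator B (Z x) \<partial>M)
        = (\<integral>x\<in>K -` A \<inter> space M. measure (\<kappa> (K x)) B \<partial>M)
      \<longleftrightarrow> emeasure M {x \<in> space M. K x \<in> A \<and> Z x \<in> B}
        = (\<integral>\<^sup>+x. indicator A (K x) * emeasure (\<kappa> (K x)) B \<partial>M)"
    if "A \<in> sets L" "B \<in> sets N" for A B
  proof -
    have "0 \<le> (\<integral>x\<in>K -` A \<inter> space M. measure (\<kappa> (K x)) B \<partial>M)"
      unfolding set_lebesgue_integral_def by (rule Bochner_Integration.integral_nonneg) auto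
    then show ?thesis
      using that by (simp add: set_integral_indicator_eq_measure[OF Z K]
        set_integral_kernel_eq_nn_integral[OF M K \<kappa>, symmetric] emeasure_eq_measure)
  qed
  have "(AE x in M. real_cond_exp M ?F (\<lambda>x. indicator B (Z x)) x = measure (\<kappa> (K x)) B)
      \<longleftrightarrow> (\<forall>A\<in>sets L. (\<integral>x\<in>K -` A \<inter> space M. indicator B (Z x) \<partial>M)
        = (\<integral>x\<in>K -` A \<inter> space M. measure (\<kappa> (K x)) B \<partial>M))" (is "?ae \<longleftrightarrow> ?int")
    if B[measurable]: "B \<in> sets N" for B
  proof
    assume ae: ?ae
    show ?int
    proof
      fix A assume [measurable]: "A \<in> sets L"
      have "(\<integral>x\<in>K -` A \<inter> space M. indicator B (Z x) \<partial>M)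
          = (\<integral>x\<in>K -` A \<inter> space M. real_cond_exp M ?F (\<lambda>x. indicator B (Z x)) x \<partial>M)"
        by (rule real_cond_exp_intA[OF intZ[OF B]]) (auto simp: F)
      also have "\<dots> = (\<integral>x\<in>K -` A \<inter> space M. measure (\<kappa> (K x)) B \<partial>M)"
        unfolding set_lebesgue_integral_def
        using ae borel_measurable_integrable[OF intk[OF B]] by (intro integral_cong_AE) auto
      finally show "(\<integral>x\<in>K -` A \<inter> space M. indicator B (Z x) \<partial>M)
          = (\<integral>x\<in>K -` A \<inter> space M. measure (\<kappa> (K x)) B \<partial>M)" .
    qed
  next
    assume ?int
    moreover have "(\<lambda>x. measure (\<kappa> (K x)) B) \<in> borel_measurable ?F"
    proof (rule measurable_compose[of K _ L])
      show "K \<in> ?F \<rightarrow>\<^sub>M L"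
        by (rule measurable_vimage_algebra1) (use measurable_space[OF K] in auto)
      show "(\<lambda>k. measure (\<kappa> k) B) \<in> borel_measurable L"
        using measure_measurable_prob_algebra2[of L "\<lambda>_. B" N \<kappa>] by auto
    qed
    ultimately show ?ae
      using intZ[OF B] intk[OF B] by (intro real_cond_exp_charact) (auto simp: F)
  qed
  then show ?thesis
    using \<kappa> rect unfolding cond_distribution_def by blast
qed

text \<open>
  Disintegration: the joint law of \<open>(K, Z)\<close> and the law obtained by drawing \<open>K\<close> and then \<open>z\<close> from
  \<open>\<kappa> K\<close> agree on rectangles, hence everywhere.
\<close>

lemma cond_distribution_nn_integral:
  assumes M: "prob_space M" and Z[measurable]: "Z \<in> M \<rightarrow>\<^sub>M N" and K[measurable]: "K \<in> M \<rightarrow>\<^sub>M L"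
    and cd: "cond_distribution M N Z L K \<kappa>"
    and F[measurable]: "F \<in> borel_measurable (L \<Otimes>\<^sub>M N)"
  shows "(\<integral>\<^sup>+x. F (K x, Z x) \<partial>M) = (\<integral>\<^sup>+x. \<integral>\<^sup>+z. F (K x, z) \<partial>\<kappa> (K x) \<partial>M)"
proof -
  interpret prob_space M by fact
  have \<kappa>[measurable]: "\<kappa> \<in> L \<rightarrow>\<^sub>M prob_algebra N"
    using cd by (simp add: cond_distribution_def)
  define J where "J = distr M (L \<Otimes>\<^sub>M N) (\<lambda>x. (K x, Z x))"
  \<comment> \<open>Given the data \<open>x\<close>, the value of \<open>K\<close> is kept and \<open>Z\<close> is drawn afresh from the kernel.\<close>
  define \<rho> where "\<rho> x = distr (\<kappa> (K x)) (L \<Otimes>\<^sub>M N) (Pair (K x))" for x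
  have setsk: "sets (\<kappa> (K x)) = sets N" and spaceK: "K x \<in> space L" if "x \<in> space M" for x
    using measurable_space[OF \<kappa> measurable_space[OF K that]] measurable_space[OF K that]
    by (auto simp: space_prob_algebra)
  have \<rho>p: "\<rho> \<in> M \<rightarrow>\<^sub>M prob_algebra (L \<Otimes>\<^sub>M N)"
    unfolding \<rho>_def by (rule measurable_distr_prob_space2[where M=N]) measurable
  then have \<rho>: "\<rho> \<in> M \<rightarrow>\<^sub>M subprob_algebra (L \<Otimes>\<^sub>M N)"
    by (rule measurable_prob_algebraD)
  have int\<rho>: "(\<integral>\<^sup>+y. G y \<partial>(M \<bind> \<rho>)) = (\<integral>\<^sup>+x. \<integral>\<^sup>+z. G (K x, z) \<partial>\<kappa> (K x) \<partial>M)"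
    if G[measurable]: "G \<in> borel_measurable (L \<Otimes>\<^sub>M N)" for G
  proof -
    have "(\<integral>\<^sup>+y. G y \<partial>\<rho> x) = (\<integral>\<^sup>+z. G (K x, z) \<partial>\<kappa> (K x))" if "x \<in> space M" for x
    proof -
      have "Pair (K x) \<in> \<kappa> (K x) \<rightarrow>\<^sub>M L \<Otimes>\<^sub>M N"
        unfolding measurable_cong_sets[OF setsk[OF that] refl]
        using spaceK[OF that] by (rule measurable_Pair1')
      then show ?thesis unfolding \<rho>_def by (simp add: nn_integral_distr)
    qed
    then show ?thesis
      by (subst nn_integral_bind[OF G \<rho>]) (rule nn_integral_cong)
  qed
  have "J = M \<bind> \<rho>"
  proof (rule measure_eqI_generator_eq[where \<Omega>="space L \<times> space N" and A="\<lambda>_. space L \<times> space N"])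
    show "Int_stable {A \<times> B | A B. A \<in> sets L \<and> B \<in> sets N}"
      by (rule Int_stable_pair_measure_generator)
    show "{A \<times> B | A B. A \<in> sets L \<and> B \<in> sets N} \<subseteq> Pow (space L \<times> space N)"
      by (rule pair_measure_closed)
    show "sets J = sigma_sets (space L \<times> space N) {A \<times> B | A B. A \<in> sets L \<and> B \<in> sets N}"
      by (simp add: J_def sets_pair_measure)
    show "sets (M \<bind> \<rho>) = sigma_sets (space L \<times> space N) {A \<times> B | A B. A \<in> sets L \<and> B \<in> sets N}"
      using sets_bind[OF sets_kernel[OF \<rho>] not_empty] by (simp add: sets_pair_measure)
    show "emeasure J (space L \<times> space N) \<noteq> \<infinity>"
      unfolding J_def by (subst emeasure_distr) (auto simp: emeasure_eq_measure)
    fix X assume "X \<in> {A \<times> B | A B. A \<in> sets L \<and> B \<in> sets N}"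
    then obtain A B where X: "X = A \<times> B" and [measurable]: "A \<in> sets L" "B \<in> sets N" by auto
    have "emeasure J X = emeasure M {x \<in> space M. K x \<in> A \<and> Z x \<in> B}"
      unfolding J_def X by (subst emeasure_distr) (auto intro!: arg_cong[where f="emeasure M"])
    also have "\<dots> = (\<integral>\<^sup>+x. indicator A (K x) * emeasure (\<kappa> (K x)) B \<partial>M)"
      using cd cond_distribution_iff_rectangles[OF M Z K \<kappa>] by simp
    also have "\<dots> = (\<integral>\<^sup>+x. \<integral>\<^sup>+z. indicator X (K x, z) \<partial>\<kappa> (K x) \<partial>M)"
    proof (rule nn_integral_cong)
      fix x assume "x \<in> space M"
      then have "B \<in> sets (\<kappa> (K x))"
        by (simp add: setsk)
      then show "indicator A (K x) * emeasure (\<kappa> (K x)) B = (\<integral>\<^sup>+z. indicator X (K x, z) \<partial>\<kappa> (K x))"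
        by (simp add: X indicator_times nn_integral_cmult_indicator)
    qed
    also have "\<dots> = (\<integral>\<^sup>+y. indicator X y \<partial>(M \<bind> \<rho>))"
      by (rule int\<rho>[symmetric]) (simp add: X)
    also have "\<dots> = emeasure (M \<bind> \<rho>) X"
      using sets_bind[OF sets_kernel[OF \<rho>] not_empty] by (intro nn_integral_indicator) (simp add: X)
    finally show "emeasure J X = emeasure (M \<bind> \<rho>) X" .
  qed auto
  then have "(\<integral>\<^sup>+y. F y \<partial>J) = (\<integral>\<^sup>+x. \<integral>\<^sup>+z. F (K x, z) \<partial>\<kappa> (K x) \<partial>M)"
    using int\<rho>[OF F] by simp
  then show ?thesis
    unfolding J_def by (subst (asm) nn_integral_distr) auto
qed

section \<open>Quadratic log likelihoods\<close>

locale quadratic_loglik_model = probability_model lam f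
  for lam :: "'a measure" and f :: "real ^ 'p \<Rightarrow> 'a \<Rightarrow> real" +
  fixes u U :: "'a \<Rightarrow> real" and Z :: "'a \<Rightarrow> real ^ 'p" and K :: "'a \<Rightarrow> real ^ 'p ^ 'p"
  assumes Z_lam: "Z \<in> borel_measurable lam"
    and K_lam: "K \<in> borel_measurable lam"
    and K_symmetric: "\<And>x. x \<in> space lam \<Longrightarrow> transpose (K x) = K x"
    and quadratic_loglik: "\<And>\<theta>. AE x in model lam f \<theta>.
           loglik u f \<theta> x = U x + Z x \<bullet> \<theta> - 1 / 2 * (\<theta> \<bullet> (K x *v \<theta>))"
begin

abbreviation P :: "real ^ 'p \<Rightarrow> 'a measure" where
  "P \<theta> \<equiv> model lam f \<theta>"

lemma sets_P [measurable_cong]: "sets (P \<theta>) = sets lam"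
  by (simp add: model_def)

lemma space_P [simp]: "space (P \<theta>) = space lam"
  by (simp add: model_def)

declare Z_lam [measurable] K_lam [measurable] density_measurable [measurable]

lemma AE_P_iff: "(AE x in P \<theta>. Q x) \<longleftrightarrow> (AE x in lam. 0 < f \<theta> x \<longrightarrow> Q x)"
  unfolding model_def by (subst AE_density) auto

text \<open>
  The log likelihood ratio between \<open>\<theta> + t\<close> and \<open>\<theta>\<close>, arranged around the score \<open>Z - K \<theta>\<close> at \<open>\<theta>\<close>: in this form
  the model looks the same from every base point.
\<close>

definition log_ratio :: "real ^ 'p \<Rightarrow> real ^ 'p \<Rightarrow> 'a \<Rightarrow> real" where
  "log_ratio \<theta> t x = t \<bullet> (Z x - K x *v \<theta>) - (t \<bullet> (K x *v t)) / 2"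

lemma log_ratio_measurable [measurable]: "log_ratio \<theta> t \<in> borel_measurable lam"
  unfolding log_ratio_def[abs_def] by measurable

lemma log_ratio_eq:
  assumes "x \<in> space lam"
  shows "(Z x \<bullet> (\<theta> + t) - 1 / 2 * ((\<theta> + t) \<bullet> (K x *v (\<theta> + t))))
    - (Z x \<bullet> \<theta> - 1 / 2 * (\<theta> \<bullet> (K x *v \<theta>))) = log_ratio \<theta> t x"
proof -
  have "\<theta> \<bullet> (K x *v t) = (\<theta> v* K x) \<bullet> t"
    by (simp add: dot_lmul_matrix)
  also have "\<dots> = t \<bullet> (K x *v \<theta>)"
    using K_symmetric[OF assms] by (metis inner_commute transpose_matrix_vector)
  finally show ?thesis
    unfolding log_ratio_def
    by (simp add: inner_add_left inner_add_right inner_diff_right matrix_vector_right_distrib inner_commute[of "Z x"] field_simps)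
qed

text \<open>
  The quadratic form of the log likelihood is known only almost surely under the parameter value in
  question; mutual absolute continuity makes both instances valid where \<open>f \<theta>\<close> is positive, and makes \<open>f (\<theta> + t)\<close>
  vanish almost everywhere else.
\<close>

lemma model_shift: "P (\<theta> + t) = density (P \<theta>) (\<lambda>x. ennreal (exp (log_ratio \<theta> t x)))"
proof -
  have "AE x in lam. f (\<theta> + t) x = f \<theta> x * exp (log_ratio \<theta> t x)"
    using density_pos[of \<theta> "\<theta> + t", unfolded AE_P_iff] density_pos[of "\<theta> + t" \<theta>, unfolded AE_P_iff]
      quadratic_loglik[of \<theta>, unfolded AE_P_iff] quadratic_loglik[of "\<theta> + t", unfolded AE_P_iff]
      AE_space
  proof eventually_elim
    case (elim x)
    show ?case
    proof (cases "0 < f \<theta> x")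
      case True
      then have pos: "0 < f (\<theta> + t) x" using elim by simp
      have "ln (f (\<theta> + t) x) = ln (f \<theta> x) + log_ratio \<theta> t x"
        using elim True pos log_ratio_eq[of x \<theta> t] by (simp add: loglik_def)
      then have "exp (ln (f (\<theta> + t) x)) = exp (ln (f \<theta> x)) * exp (log_ratio \<theta> t x)"
        by (simp add: exp_add)
      then show ?thesis using True pos by simp
    next
      case False
      then show ?thesis
        using elim density_nonneg[of x \<theta>] density_nonneg[of x "\<theta> + t"] by force
    qed
  qed
  then have "AE x in lam. ennreal (f (\<theta> + t) x) = ennreal (f \<theta> x) * ennreal (exp (log_ratio \<theta> t x))"
    by eventually_elim (simp add: ennreal_mult'')
  then show ?thesis
    unfolding model_def by (subst density_density_eq) (auto intro!: density_cong)
qed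

lemma nn_integral_shift:
  assumes [measurable]: "g \<in> borel_measurable lam"
  shows "(\<integral>\<^sup>+x. g x \<partial>P (\<theta> + t)) = (\<integral>\<^sup>+x. ennreal (exp (log_ratio \<theta> t x)) * g x \<partial>P \<theta>)"
  unfolding model_shift by (rule nn_integral_density) measurable

lemma expectation_likelihood_ratio: "(\<integral>\<^sup>+x. ennreal (exp (log_ratio \<theta> t x)) \<partial>P \<theta>) = 1"
  using nn_integral_shift[of "\<lambda>_. 1" \<theta> t] prob_space.emeasure_space_1[OF prob_space_model[of "\<theta> + t"]]
  by simp

text \<open>
  Averaging the likelihood ratios at \<open>s v\<close> and \<open>- s v\<close> gives \<open>cosh (s Y) exp (- s\<^sup>2 q / 2)\<close> with \<open>q = v \<bullet> K v\<close> and
  \<open>Y\<close> the score in direction \<open>v\<close>.  Its mean is one for every \<open>s\<close>.  On the event \<open>q \<le> - \<epsilon>\<close> it is at least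
  \<open>exp (s\<^sup>2 \<epsilon> / 2)\<close>, which grows without bound, so this event is null.
\<close>

lemma K_direction_nonneg: "AE x in P \<theta>. 0 \<le> v \<bullet> (K x *v v)"
proof -
  interpret prob_space "P \<theta>" by (rule prob_space_model)
  let ?q = "\<lambda>x. v \<bullet> (K x *v v)"
  have null: "emeasure (P \<theta>) {x \<in> space lam. ?q x \<le> - \<epsilon>} = 0" if "0 < \<epsilon>" for \<epsilon>
  proof -
    let ?A = "{x \<in> space lam. ?q x \<le> - \<epsilon>}"
    have [measurable]: "?A \<in> sets lam" by measurable
    have bound: "exp (s\<^sup>2 * \<epsilon> / 2) * prob ?A \<le> 1" for s
    proof -
      have "ennreal (2 * exp (s\<^sup>2 * \<epsilon> / 2)) * emeasure (P \<theta>) ?A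
          = (\<integral>\<^sup>+x. ennreal (2 * exp (s\<^sup>2 * \<epsilon> / 2)) * indicator ?A x \<partial>P \<theta>)"
        by (rule nn_integral_cmult_indicator[symmetric]) measurable
      also have "\<dots> \<le> (\<integral>\<^sup>+x. ennreal (exp (log_ratio \<theta> (s *\<^sub>R v) x)) + ennreal (exp (log_ratio \<theta> (- s *\<^sub>R v) x)) \<partial>P \<theta>)"
      proof (rule nn_integral_mono)
        fix x
        define y where "y = s * (v \<bullet> (Z x - K x *v \<theta>))"
        have ratio: "log_ratio \<theta> (s *\<^sub>R v) x = y - s\<^sup>2 * ?q x / 2"
          "log_ratio \<theta> (- s *\<^sub>R v) x = - y - s\<^sup>2 * ?q x / 2"
          by (simp_all add: log_ratio_def y_def power2_eq_square matrix_vector_mult_scaleR linear_neg[OF matrix_vector_mul_linear] mult_ac)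
        have "2 * exp (s\<^sup>2 * \<epsilon> / 2) \<le> exp (y - s\<^sup>2 * ?q x / 2) + exp (- y - s\<^sup>2 * ?q x / 2)"
          if "?q x \<le> - \<epsilon>"
        proof -
          have "2 \<le> exp y + exp (- y)"
            using cosh_real_ge_1[of y] by (simp add: cosh_def)
          moreover have "s\<^sup>2 * \<epsilon> \<le> s\<^sup>2 * (- ?q x)"
            using that by (intro mult_left_mono) auto
          then have "exp (s\<^sup>2 * \<epsilon> / 2) \<le> exp (- s\<^sup>2 * ?q x / 2)"
            by simp
          ultimately have "2 * exp (s\<^sup>2 * \<epsilon> / 2) \<le> (exp y + exp (- y)) * exp (- s\<^sup>2 * ?q x / 2)"
            by (intro mult_mono) auto
          then show ?thesis by (simp add: distrib_right flip: exp_add)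
        qed
        then show "ennreal (2 * exp (s\<^sup>2 * \<epsilon> / 2)) * indicator ?A x
            \<le> ennreal (exp (log_ratio \<theta> (s *\<^sub>R v) x)) + ennreal (exp (log_ratio \<theta> (- s *\<^sub>R v) x))"
          unfolding ratio by (auto simp flip: ennreal_plus split: split_indicator)
      qed
      also have "\<dots> = ennreal 2"
        by (subst nn_integral_add) (simp_all add: expectation_likelihood_ratio)
      finally have "ennreal (2 * exp (s\<^sup>2 * \<epsilon> / 2) * prob ?A) \<le> ennreal 2"
        unfolding emeasure_eq_measure by (subst ennreal_mult') auto
      then show ?thesis
        by (subst (asm) ennreal_le_iff) auto
    qed
    have "prob ?A = 0"
    proof (rule ccontr)
      assume "prob ?A \<noteq> 0"
      then have p: "0 < prob ?A" by (simp add: zero_less_measure_iff)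
      \<comment> \<open>With this \<open>s\<close> the estimate \<open>1 + y \<le> exp y\<close> already contradicts the bound.\<close>
      define s where "s = sqrt (2 / (\<epsilon> * prob ?A))"
      have "s\<^sup>2 * \<epsilon> / 2 = 1 / prob ?A"
        using p that by (simp add: s_def)
      then have "exp (s\<^sup>2 * \<epsilon> / 2) * prob ?A \<ge> (1 + 1 / prob ?A) * prob ?A"
        by (intro mult_right_mono) (auto simp: exp_ge_add_one_self)
      with bound[of s] p show False by (simp add: distrib_right)
    qed
    then show ?thesis by (simp add: emeasure_eq_measure)
  qed
  have "AE x in P \<theta>. - (1 / real (Suc n)) < ?q x" for n
    by (rule AE_I[OF _ null[of "1 / real (Suc n)"]]) auto
  then have "AE x in P \<theta>. \<forall>n. - (1 / real (Suc n)) < ?q x"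
    by (simp add: AE_all_countable)
  then show ?thesis
  proof eventually_elim
    case (elim x)
    show ?case
    proof (rule ccontr)
      assume "\<not> 0 \<le> ?q x"
      then obtain n where "1 / real (Suc n) < - ?q x"
        using nat_approx_posE[of "- ?q x"] by auto
      then show False using elim[rule_format, of n] by simp
    qed
  qed
qed

text \<open>
  The exceptional null set for a direction \<open>v\<close> depends on \<open>v\<close>; countably many dense directions suffice
  because the quadratic form is continuous.
\<close>

lemma K_psd: "AE x in P \<theta>. psd (K x)"
proof -
  obtain D :: "(real ^ 'p) set" where "countable D"
    and dense: "\<And>X. open X \<Longrightarrow> X \<noteq> {} \<Longrightarrow> \<exists>d\<in>D. d \<in> X"
    using countable_dense_exists by blast
  then have "AE x in P \<theta>. \<forall>v\<in>D. 0 \<le> v \<bullet> (K x *v v)"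
    using K_direction_nonneg by (simp add: AE_ball_countable)
  then show ?thesis
    using AE_space
  proof eventually_elim
    case (elim x)
    have "0 \<le> v \<bullet> (K x *v v)" for v
    proof (rule ccontr)
      assume "\<not> 0 \<le> v \<bullet> (K x *v v)"
      then have "{v. v \<bullet> (K x *v v) < 0} \<noteq> {}"
        by (auto simp: not_le)
      moreover have "open {v. v \<bullet> (K x *v v) < 0}"
        by (intro open_Collect_less continuous_intros matrix_vector_mult_linear_continuous_on)
      ultimately obtain d where "d \<in> D" "d \<bullet> (K x *v d) < 0"
        using dense by blast
      then show False using elim(1) by (simp add: leD)
    qed
    then show ?case using elim K_symmetric by (simp add: psd_def)
  qed
qed

text \<open>
  Passing from \<open>\<theta>\<close> to \<open>\<theta> + t\<close> reweights the data by the likelihood ratio.  Its conditional mean given \<open>K\<close> is one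
  when \<open>Z\<close> is conditionally normal, so events about \<open>K\<close> keep their probability.
\<close>

lemma distr_K_shift:
  assumes cd: "cond_distribution (P \<theta>) borel Z borel K (\<lambda>k. mvn (k *v \<theta>) k)"
  shows "distr (P (\<theta> + t)) borel K = distr (P \<theta>) borel K"
proof (rule measure_eqI)
  fix A assume "A \<in> sets (distr (P (\<theta> + t)) borel K)"
  then have [measurable]: "A \<in> sets borel" by simp
  define F where "F = (\<lambda>(k, z). ennreal (exp (t \<bullet> (z - k *v \<theta>) - (t \<bullet> (k *v t)) / 2)) * indicator A k)"
  have [measurable]: "F \<in> borel_measurable (borel \<Otimes>\<^sub>M borel)"
    unfolding F_def by measurable
  have em: "emeasure (distr (P \<eta>) borel K) A = (\<integral>\<^sup>+x. indicator A (K x) \<partial>P \<eta>)" for \<eta>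
    using nn_integral_distr[of K "P \<eta>" borel "indicator A"] by simp
  have "emeasure (distr (P (\<theta> + t)) borel K) A = (\<integral>\<^sup>+x. F (K x, Z x) \<partial>P \<theta>)"
    unfolding em by (subst nn_integral_shift) (auto simp: F_def log_ratio_def)
  also have "\<dots> = (\<integral>\<^sup>+x. \<integral>\<^sup>+z. F (K x, z) \<partial>mvn (K x *v \<theta>) (K x) \<partial>P \<theta>)"
    by (rule cond_distribution_nn_integral[OF prob_space_model _ _ cd]) measurable
  also have "\<dots> = (\<integral>\<^sup>+x. indicator A (K x) \<partial>P \<theta>)"
  proof (rule nn_integral_cong_AE)
    show "AE x in P \<theta>. (\<integral>\<^sup>+z. F (K x, z) \<partial>mvn (K x *v \<theta>) (K x)) = indicator A (K x)"
      using K_psd[of \<theta>] by eventually_elim (auto simp: F_def nn_integral_likelihood_ratio_mvn split: split_indicator)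
  qed
  finally show "emeasure (distr (P (\<theta> + t)) borel K) A = emeasure (distr (P \<theta>) borel K) A"
    unfolding em .
qed simp

text \<open>
  The reason why the law of \<open>K\<close> carries so much information: \<open>exp (t \<bullet> Z)\<close> is the likelihood ratio between
  \<open>\<theta> + t\<close> and \<open>\<theta>\<close> times a function of \<open>K\<close>.  The ratio is absorbed by passing to \<open>\<theta> + t\<close>, and by invariance
  a function of \<open>K\<close> has the same mean there as at \<open>\<theta>\<close>.  The function of \<open>K\<close> is the normal moment generating function.
\<close>

lemma conditional_mgf:
  assumes inv: "\<And>\<theta> \<theta>'. distr (P \<theta>) borel K = distr (P \<theta>') borel K"
    and [measurable]: "A \<in> sets borel"
  shows "(\<integral>\<^sup>+x. indicator A (K x) * ennreal (exp (t \<bullet> Z x)) \<partial>P \<theta>)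
    = (\<integral>\<^sup>+x. indicator A (K x) * ennreal (exp (t \<bullet> (K x *v \<theta>) + (t \<bullet> (K x *v t)) / 2)) \<partial>P \<theta>)"
proof -
  define g where "g k = indicator A k * ennreal (exp (t \<bullet> (k *v \<theta>) + (t \<bullet> (k *v t)) / 2))" for k
  have g[measurable]: "g \<in> borel_measurable borel"
    unfolding g_def by measurable
  have "(\<integral>\<^sup>+x. indicator A (K x) * ennreal (exp (t \<bullet> Z x)) \<partial>P \<theta>)
      = (\<integral>\<^sup>+x. ennreal (exp (log_ratio \<theta> t x)) * g (K x) \<partial>P \<theta>)"
    by (rule nn_integral_cong)
       (auto simp: g_def log_ratio_def inner_diff_right simp flip: ennreal_mult' exp_add split: split_indicator)
  also have "\<dots> = (\<integral>\<^sup>+x. g (K x) \<partial>P (\<theta> + t))"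
    by (rule nn_integral_shift[symmetric]) measurable
  also have "\<dots> = (\<integral>\<^sup>+k. g k \<partial>distr (P (\<theta> + t)) borel K)"
    by (rule nn_integral_distr[symmetric]) measurable
  also have "\<dots> = (\<integral>\<^sup>+k. g k \<partial>distr (P \<theta>) borel K)"
    using inv by metis
  also have "\<dots> = (\<integral>\<^sup>+x. g (K x) \<partial>P \<theta>)"
    by (rule nn_integral_distr) measurable
  finally show ?thesis unfolding g_def .
qed

text \<open>
  For fixed \<open>A\<close> both sides are finite measures in \<open>B\<close> with the same moment generating function.  Boundedness of
  \<open>A\<close> keeps that function finite; the variable \<open>K\<close> itself may fail to have exponential moments.
\<close>

lemma bounded_rectangle_mvn:
  assumes inv: "\<And>\<theta> \<theta>'. distr (P \<theta>) borel K = distr (P \<theta>') borel K"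
    and A[measurable]: "A \<in> sets borel" and bdd: "bounded A" and B[measurable]: "B \<in> sets borel"
  shows "emeasure (P \<theta>) {x \<in> space (P \<theta>). K x \<in> A \<and> Z x \<in> B}
    = (\<integral>\<^sup>+x. indicator A (K x) * emeasure (mvn (K x *v \<theta>) (K x)) B \<partial>P \<theta>)"
proof -
  interpret prob_space "P \<theta>" by (rule prob_space_model)
  define R where "R = density (P \<theta>) (\<lambda>x. indicator A (K x))"
  define \<rho> where "\<rho> x = mvn (K x *v \<theta>) (K x)" for x
  have sR[measurable_cong]: "sets R = sets lam" and spR: "space R = space lam"
    by (simp_all add: R_def sets_P)
  have intR: "(\<integral>\<^sup>+x. h x \<partial>R) = (\<integral>\<^sup>+x. indicator A (K x) * h x \<partial>P \<theta>)"
    if [measurable]: "h \<in> borel_measurable lam" for h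
    unfolding R_def by (rule nn_integral_density) measurable
  have ne: "space R \<noteq> {}"
    using not_empty by (simp add: spR)
  have "\<rho> \<in> lam \<rightarrow>\<^sub>M prob_algebra borel"
    unfolding \<rho>_def by measurable
  then have \<rho>lam: "\<rho> \<in> lam \<rightarrow>\<^sub>M subprob_algebra borel"
    by (rule measurable_prob_algebraD)
  then have \<rho>: "\<rho> \<in> R \<rightarrow>\<^sub>M subprob_algebra borel"
    by (simp cong: measurable_cong_sets add: sR)
  have s\<rho>: "sets (\<rho> x) = sets borel" for x
    by (simp add: \<rho>_def mvn_def)
  have intb: "(\<integral>\<^sup>+z. h z \<partial>(R \<bind> \<rho>)) = (\<integral>\<^sup>+x. indicator A (K x) * (\<integral>\<^sup>+z. h z \<partial>\<rho> x) \<partial>P \<theta>)"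
    if h[measurable]: "h \<in> borel_measurable borel" for h
  proof -
    have "(\<integral>\<^sup>+z. h z \<partial>(R \<bind> \<rho>)) = (\<integral>\<^sup>+x. \<integral>\<^sup>+z. h z \<partial>\<rho> x \<partial>R)"
      by (rule nn_integral_bind[OF h \<rho>])
    also have "\<dots> = (\<integral>\<^sup>+x. indicator A (K x) * (\<integral>\<^sup>+z. h z \<partial>\<rho> x) \<partial>P \<theta>)"
      by (rule intR) (rule measurable_compose[OF \<rho>lam nn_integral_measurable_subprob_algebra[OF h]])
    finally show ?thesis .
  qed
  have sb: "sets (R \<bind> \<rho>) = sets borel"
    by (rule sets_bind[OF s\<rho> ne])
  let ?e = "\<lambda>t k. t \<bullet> (k *v \<theta>) + (t \<bullet> (k *v t)) / 2"
  have mgfZ: "(\<integral>\<^sup>+z. ennreal (exp (t \<bullet> z)) \<partial>distr R borel Z)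
      = (\<integral>\<^sup>+x. indicator A (K x) * ennreal (exp (?e t (K x))) \<partial>P \<theta>)" for t
  proof -
    have "(\<integral>\<^sup>+z. ennreal (exp (t \<bullet> z)) \<partial>distr R borel Z) = (\<integral>\<^sup>+x. ennreal (exp (t \<bullet> Z x)) \<partial>R)"
      by (rule nn_integral_distr) measurable
    also have "\<dots> = (\<integral>\<^sup>+x. indicator A (K x) * ennreal (exp (t \<bullet> Z x)) \<partial>P \<theta>)"
      by (rule intR) measurable
    finally show ?thesis using conditional_mgf[OF inv A] by simp
  qed
  \<comment> \<open>On the event \<open>K \<in> A\<close>, the law of \<open>Z\<close> is the mixture of the normal laws.\<close>
  have "distr R borel Z = R \<bind> \<rho>"
  proof (rule measure_eqI_mgf)
    fix t
    have "(\<integral>\<^sup>+z. ennreal (exp (t \<bullet> z)) \<partial>(R \<bind> \<rho>))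
        = (\<integral>\<^sup>+x. indicator A (K x) * (\<integral>\<^sup>+z. ennreal (exp (t \<bullet> z)) \<partial>\<rho> x) \<partial>P \<theta>)"
      by (rule intb) measurable
    also have "\<dots> = (\<integral>\<^sup>+x. indicator A (K x) * ennreal (exp (?e t (K x))) \<partial>P \<theta>)"
    proof (rule nn_integral_cong_AE)
      show "AE x in P \<theta>. indicator A (K x) * (\<integral>\<^sup>+z. ennreal (exp (t \<bullet> z)) \<partial>\<rho> x)
          = indicator A (K x) * ennreal (exp (?e t (K x)))"
        using K_psd[of \<theta>] by eventually_elim (simp add: \<rho>_def mgf_mvn)
    qed
    finally show "(\<integral>\<^sup>+z. ennreal (exp (t \<bullet> z)) \<partial>distr R borel Z)
        = (\<integral>\<^sup>+z. ennreal (exp (t \<bullet> z)) \<partial>(R \<bind> \<rho>))"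
      unfolding mgfZ by simp
    have "compact (?e t ` closure A)"
      using bdd unfolding matrix_vector_mult_def inner_vec_def
      by (intro compact_continuous_image continuous_intros) (simp_all add: compact_closure)
    then obtain c where c: "\<And>k. k \<in> A \<Longrightarrow> ?e t k \<le> c"
      using closure_subset[of A] bounded_has_Sup(1)[OF compact_imp_bounded] by blast
    have "(\<integral>\<^sup>+z. ennreal (exp (t \<bullet> z)) \<partial>distr R borel Z) \<le> (\<integral>\<^sup>+x. ennreal (exp c) \<partial>P \<theta>)"
      unfolding mgfZ using c by (intro nn_integral_mono) (auto split: split_indicator)
    also have "\<dots> < \<infinity>"
      using emeasure_space_1 by simp
    finally show "(\<integral>\<^sup>+z. ennreal (exp (t \<bullet> z)) \<partial>distr R borel Z) < \<infinity>" .
  qed (simp_all add: sb)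
  then have "emeasure (distr R borel Z) B = (\<integral>\<^sup>+z. indicator B z \<partial>(R \<bind> \<rho>))"
    by (simp add: sb)
  also have "\<dots> = (\<integral>\<^sup>+x. indicator A (K x) * emeasure (\<rho> x) B \<partial>P \<theta>)"
    by (subst intb) (simp_all add: s\<rho>)
  also have "emeasure (distr R borel Z) B = (\<integral>\<^sup>+x. indicator B (Z x) \<partial>R)"
    using nn_integral_distr[of Z R borel "indicator B"] by simp
  also have "\<dots> = (\<integral>\<^sup>+x. indicator A (K x) * indicator B (Z x) \<partial>P \<theta>)"
    by (rule intR) measurable
  also have "\<dots> = (\<integral>\<^sup>+x. indicator {x \<in> space (P \<theta>). K x \<in> A \<and> Z x \<in> B} x \<partial>P \<theta>)"
    by (rule nn_integral_cong) (auto split: split_indicator)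
  also have "\<dots> = emeasure (P \<theta>) {x \<in> space (P \<theta>). K x \<in> A \<and> Z x \<in> B}"
    by (rule nn_integral_indicator) measurable
  finally show ?thesis unfolding \<rho>_def .
qed

text \<open>
  For fixed \<open>B\<close> both sides of the rectangle criterion are measures in \<open>A\<close>, so the restriction to bounded \<open>A\<close>
  is removed by exhausting the matrix space with balls.
\<close>

lemma cond_distribution_mvn:
  assumes inv: "\<And>\<theta> \<theta>'. distr (P \<theta>) borel K = distr (P \<theta>') borel K"
  shows "cond_distribution (P \<theta>) borel Z borel K (\<lambda>k. mvn (k *v \<theta>) k)"
proof -
  have \<kappa>: "(\<lambda>k. mvn (k *v \<theta>) k) \<in> borel \<rightarrow>\<^sub>M prob_algebra (borel :: (real ^ 'p) measure)"
    by measurable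
  have "emeasure (P \<theta>) {x \<in> space (P \<theta>). K x \<in> A \<and> Z x \<in> B}
      = (\<integral>\<^sup>+x. indicator A (K x) * emeasure (mvn (K x *v \<theta>) (K x)) B \<partial>P \<theta>)"
    if A[measurable]: "A \<in> sets borel" and B[measurable]: "B \<in> sets borel" for A B
  proof -
    define \<mu> where "\<mu> = distr (density (P \<theta>) (\<lambda>x. indicator B (Z x))) borel K"
    define \<nu> where "\<nu> = density (distr (P \<theta>) borel K) (\<lambda>k. emeasure (mvn (k *v \<theta>) k) B)"
    have [measurable]: "(\<lambda>k. emeasure (mvn (k *v \<theta>) k) B) \<in> borel_measurable borel"
      by (rule measurable_emeasure_kernel[OF measurable_prob_algebraD[OF \<kappa>] B])
    have \<mu>: "emeasure \<mu> C = emeasure (P \<theta>) {x \<in> space (P \<theta>). K x \<in> C \<and> Z x \<in> B}"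
      if [measurable]: "C \<in> sets borel" for C
    proof -
      have "emeasure \<mu> C = emeasure (density (P \<theta>) (\<lambda>x. indicator B (Z x))) (K -` C \<inter> space lam)"
        unfolding \<mu>_def by (subst emeasure_distr) auto
      also have "\<dots> = (\<integral>\<^sup>+x. indicator B (Z x) * indicator (K -` C \<inter> space lam) x \<partial>P \<theta>)"
        by (rule emeasure_density) measurable
      also have "\<dots> = (\<integral>\<^sup>+x. indicator {x \<in> space (P \<theta>). K x \<in> C \<and> Z x \<in> B} x \<partial>P \<theta>)"
        by (rule nn_integral_cong) (auto split: split_indicator)
      also have "\<dots> = emeasure (P \<theta>) {x \<in> space (P \<theta>). K x \<in> C \<and> Z x \<in> B}"
        by (rule nn_integral_indicator) measurable
      finally show ?thesis .
    qed
    have \<nu>: "emeasure \<nu> C = (\<integral>\<^sup>+x. indicator C (K x) * emeasure (mvn (K x *v \<theta>) (K x)) B \<partial>P \<theta>)"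
      if [measurable]: "C \<in> sets borel" for C
      unfolding \<nu>_def by (subst emeasure_density, measurable, subst nn_integral_distr) (auto simp: mult.commute)
    have eq: "emeasure \<mu> (A \<inter> cball 0 (real n)) = emeasure \<nu> (A \<inter> cball 0 (real n))" for n
      unfolding \<mu>[of "A \<inter> cball 0 (real n)", simplified] \<nu>[of "A \<inter> cball 0 (real n)", simplified]
      using bounded_rectangle_mvn[OF inv, of "A \<inter> cball 0 (real n)" B \<theta>] by (simp add: bounded_Int)
    have exhaust: "(\<Union>n. A \<inter> cball 0 (real n)) = A"
      using real_arch_simple by auto
    have incseq: "incseq (\<lambda>n. A \<inter> cball 0 (real n))"
      by (auto simp: incseq_def)
    have SUP: "emeasure Q A = (SUP n. emeasure Q (A \<inter> cball 0 (real n)))" if "sets Q = sets borel" for Q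
    proof -
      have "A \<inter> cball 0 (real n) \<in> sets Q" for n
        unfolding that by measurable
      then have "range (\<lambda>n. A \<inter> cball 0 (real n)) \<subseteq> sets Q"
        by blast
      from SUP_emeasure_incseq[OF this incseq] show ?thesis
        unfolding exhaust by (rule sym)
    qed
    have "emeasure \<mu> A = emeasure \<nu> A"
      using SUP[of \<mu>] SUP[of \<nu>] eq by (simp add: \<mu>_def \<nu>_def)
    then show ?thesis
      using \<mu>[OF A] \<nu>[OF A] by simp
  qed
  then show ?thesis
    by (subst cond_distribution_iff_rectangles[OF prob_space_model _ _ \<kappa>]) auto
qed

end

theorem theorem3p1:
  fixes lam :: "'a measure"
    and f :: "real ^ 'p \<Rightarrow> 'a \<Rightarrow> real"
    and u U :: "'a \<Rightarrow> real"
    and Z :: "'a \<Rightarrow> real ^ 'p"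
    and K :: "'a \<Rightarrow> real ^ 'p ^ 'p"
  assumes "probability_model lam f"
    and "U \<in> borel_measurable lam"
    and "Z \<in> borel_measurable lam"
    and "K \<in> borel_measurable lam"
    and "\<And>x. x \<in> space lam \<Longrightarrow> transpose (K x) = K x"
    and "\<And>\<theta>. AE x in model lam f \<theta>.
           loglik u f \<theta> x = U x + Z x \<bullet> \<theta> - 1 / 2 * (\<theta> \<bullet> (K x *v \<theta>))"
  shows "(\<forall>\<theta>. AE x in model lam f \<theta>. psd (K x)) \<and>
    ((\<forall>\<theta>. cond_distribution (model lam f \<theta>) borel Z borel K (\<lambda>k. mvn (k *v \<theta>) k)) \<longleftrightarrow>
     (\<forall>\<theta> \<theta>'. distr (model lam f \<theta>) borel K = distr (model lam f \<theta>') borel K))"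
proof -
  interpret probability_model lam f by fact
  interpret quadratic_loglik_model lam f u U Z K
    by unfold_locales (use assms in auto)
  have "distr (P \<theta>) borel K = distr (P \<theta>') borel K"
    if "\<forall>\<theta>. cond_distribution (P \<theta>) borel Z borel K (\<lambda>k. mvn (k *v \<theta>) k)" for \<theta> \<theta>'
    using distr_K_shift[of \<theta> "\<theta>' - \<theta>"] that by simp
  then show ?thesis
    using K_psd cond_distribution_mvn by blast
qed

end
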